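(* For any prime number $p$, $$\left|\#\mathcal{B}_{-}(p)-\frac{p}{48}\right|\le 12\,p^{3/4}\log p,\qquad \left|\#\mathcal{B}_{+}(p)-\frac{p}{24}\right|\le 12\,p^{3/4}\log p,\qquad \left|\#\mathcal{B}(p)-\frac{p}{16}\right|\le 24\,p^{3/4}\log p .$$
   Context: Let $p$ be a prime. For an integer $\beta$ with $1\le\beta\le p-1$, let $\overline{\beta}$ denote the unique integer with $1\le\overline{\beta}\le p-1$ and $\beta\overline{\beta}\equiv 1 \pmod p$. Define $\mathcal{B}_{-}(p)$ = the set of integers $\beta$ with $1\le\beta\le \frac{p-3}{2}$, $\ p\le \beta+2\overline{\beta}+1$, $\ \beta>\overline{\beta}$; $\mathcal{B}_{+}(p)$ = the set of integers $\beta$ with $1\le\beta\le \frac{p-3}{2}$, $\ \beta+\overline{\beta}\ge p$, $\ \overline{\beta}\le 2\beta$; $\mathcal{B}(p)=\mathcal{B}_{-}(p)\cup\mathcal{B}_{+}(p)$. Here $\log$ is the natural logarithm and $\#S$ denotes the cardinality of $S$. *)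

theory Defs
  imports Complex_Main "HOL-Number_Theory.Number_Theory"
begin

definition inv_mod :: "nat \<Rightarrow> int \<Rightarrow> int" where
  "inv_mod p \<beta> = (THE y. 1 \<le> y \<and> y \<le> int p - 1 \<and> [\<beta> * y = 1] (mod int p))"

lemma inv_mod_eq_modular_inverse:
  assumes "prime p" and "1 \<le> \<beta>" and "\<beta> \<le> int p - 1"
  shows "inv_mod p \<beta> = modular_inverse (int p) \<beta>"
  unfolding inv_mod_def
proof (rule the_equality)
  have p: "int p > 1"
    using prime_gt_1_nat[OF assms(1)] by simp
  have "\<not> int p dvd \<beta>"
    using assms zdvd_imp_le[of "int p" \<beta>] by auto
  then have cop: "coprime \<beta> (int p)"
    using prime_imp_coprime[of "int p" \<beta>] assms(1) by (simp add: coprime_commute)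
  show "1 \<le> modular_inverse (int p) \<beta> \<and> modular_inverse (int p) \<beta> \<le> int p - 1 \<and>
      [\<beta> * modular_inverse (int p) \<beta> = 1] (mod int p)"
    using mult_modular_inverse_int_pos[OF p cop] modular_inverse_int_less[of "int p" \<beta>]
      cong_modular_inverse1[OF cop] p by auto
next
  fix y
  assume "1 \<le> y \<and> y \<le> int p - 1 \<and> [\<beta> * y = 1] (mod int p)"
  then show "y = modular_inverse (int p) \<beta>"
    using modular_inverse_int_eqI[of y "int p" \<beta>] by auto
qed

text \<open>The upper bound \<open>(p - 3) / 2\<close> is a real quotient; it is negative for \<open>p = 2\<close>,
  so both sets are then empty.\<close>

definition B_minus :: "nat \<Rightarrow> int set" where
  "B_minus p = {\<beta>. 1 \<le> \<beta> \<and> real_of_int \<beta> \<le> (real p - 3) / 2 \<and>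
     int p \<le> \<beta> + 2 * inv_mod p \<beta> + 1 \<and> \<beta> > inv_mod p \<beta>}"

definition B_plus :: "nat \<Rightarrow> int set" where
  "B_plus p = {\<beta>. 1 \<le> \<beta> \<and> real_of_int \<beta> \<le> (real p - 3) / 2 \<and>
     \<beta> + inv_mod p \<beta> \<ge> int p \<and> inv_mod p \<beta> \<le> 2 * \<beta>}"

definition B_set :: "nat \<Rightarrow> int set" where
  "B_set p = B_minus p \<union> B_plus p"

end

theory Submission
  imports Defs "HOL-Analysis.Analysis"
begin

text \<open>
  Both sets count the \<open>x\<close> in an interval whose inverse lies between two affine functions of \<open>x\<close>.
  Detecting the inverse by additive characters modulo \<open>p\<close> and summing the geometric series over
  the slice leaves incomplete sums of \<open>e (a * x\<^sup>-\<^sup>1 + h * x)\<close> over an interval, weighted by a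
  harmonic sum over \<open>a\<close>, which costs one factor \<open>ln p\<close>.

  The incomplete sums are \<open>O(p powr (3/4))\<close> without a further logarithm, and Weil's bound is not
  needed: completion gives \<open>\<Sum>b. |K(a, h + b)| / |b|\<close> with Kloosterman sums \<open>K\<close>, to which
  Hoelder's inequality with exponents \<open>4/3\<close> and \<open>4\<close> applies. Since \<open>K(a, b) = K(1, a * b)\<close>, the sum
  \<open>\<Sum>b. |K(a, b)|^4\<close> is the same for all \<open>a \<noteq> 0\<close>, so it is bounded by averaging over \<open>a\<close>, that is by
  counting the solutions of \<open>x + y = z + w\<close>, \<open>x\<^sup>-\<^sup>1 + y\<^sup>-\<^sup>1 = z\<^sup>-\<^sup>1 + w\<^sup>-\<^sup>1\<close>, all of which are trivial.
\<close>

section \<open>Elementary inequalities and sums\<close>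

text \<open>Jordan's inequality: by concavity sine lies above its chord from 0 to
  \<open>pi / 2\<close>.\<close>

lemma sin_ge_two_div_pi:
  fixes x :: real
  assumes "0 \<le> x" "x \<le> pi / 2"
  shows "2 * x / pi \<le> sin x"
proof -
  have conc: "concave_on {0..pi} sin"
  proof (rule f''_le0_imp_concave)
    fix x :: real
    assume "x \<in> {0..pi}"
    then show "- sin x \<le> 0" by (simp add: sin_ge_zero)
  qed (auto intro!: derivative_eq_intros)
  define t where "t = 2 * x / pi"
  have t: "0 \<le> t" "t \<le> 1" using assms by (auto simp: t_def field_simps)
  have "(1 - t) * sin 0 + t * sin (pi / 2) \<le> sin ((1 - t) *\<^sub>R 0 + t *\<^sub>R (pi / 2))"
    by (intro concave_onD[OF conc]) (use t in auto)
  then show ?thesis by (simp add: t_def)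
qed

text \<open>Each term after the first is at most a difference of consecutive values of
  \<open>3 * n powr (-(1/3))\<close>, so the sum telescopes. The convergence of this series is what
  spares the incomplete sums a logarithm.\<close>

lemma sum_powr_neg_four_thirds_le:
  "(\<Sum>m=1..n. real m powr (-(4/3))) \<le> 4"
proof -
  have powr_step: "real (Suc n) powr (-(4/3)) \<le> 3 * real n powr (-(1/3)) - 3 * real (Suc n) powr (-(1/3))"
    if n: "n \<ge> 1" for n :: nat
  proof -
    define s t where "s = real (Suc n) powr (1/3)" and "t = real n powr (1/3)"
    have pos: "0 < t" "t \<le> s" "0 < s" using n by (auto simp: s_def t_def intro!: powr_mono2)
    have cube: "s ^ 3 = real (Suc n)" "t ^ 3 = real n"
      using n by (simp_all add: s_def t_def powr_realpow [symmetric] powr_powr)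
    have s4: "real (Suc n) powr (-(4/3)) = 1 / s ^ 4"
      by (simp add: s_def powr_realpow [symmetric] powr_powr powr_minus_divide)
    have inv: "real (Suc n) powr (-(1/3)) = 1 / s" "real n powr (-(1/3)) = 1 / t"
      by (simp_all add: s_def t_def powr_minus_divide)
    \<comment> \<open>The integral comparison in algebraic form: factoring the difference of cubes
      bounds \<open>s - t\<close> from below by \<open>1 / (3 * s\<^sup>2)\<close>.\<close>
    have "1 = s ^ 3 - t ^ 3" using cube by simp
    also have "\<dots> = (s - t) * (s\<^sup>2 + s * t + t\<^sup>2)"
      by (simp add: algebra_simps power2_eq_square power3_eq_cube)
    also have "\<dots> \<le> (s - t) * (s\<^sup>2 + s\<^sup>2 + s\<^sup>2)"
      using pos by (intro mult_left_mono add_mono) (auto simp: power2_eq_square intro!: mult_mono)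
    finally have main: "1 \<le> 3 * (s - t) * s\<^sup>2" by (simp add: algebra_simps)
    have "1 / s ^ 4 \<le> (3 * (s - t) * s\<^sup>2) / s ^ 4"
      using main pos by (intro divide_right_mono) auto
    also have "\<dots> = 3 * (s - t) / (s * s)"
      using pos by (simp add: field_simps power2_eq_square power4_eq_xxxx)
    also have "\<dots> \<le> 3 * (s - t) / (s * t)"
      using pos by (intro divide_left_mono mult_left_mono) auto
    also have "\<dots> = 3 / t - 3 / s" using pos by (simp add: field_simps)
    finally show ?thesis unfolding s4 inv by simp
  qed
  \<comment> \<open>Keeping the telescoped remainder lets the induction close; at
    \<open>n = 1\<close> the bound is the equality \<open>1 = 4 - 3\<close>.\<close>
  have bound: "(\<Sum>m=1..n. real m powr (-(4/3))) \<le> 4 - 3 * real n powr (-(1/3))" if "n \<ge> 1" for n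
    using that
  proof (induction n rule: dec_induct)
    case base
    then show ?case by simp
  next
    case (step n)
    then show ?case using powr_step[of n] by simp
  qed
  show ?thesis
  proof (cases "n \<ge> 1")
    case True
    have "0 \<le> 3 * real n powr (-(1/3))" by simp
    with bound[OF True] show ?thesis by linarith
  qed simp
qed

lemma sum_inverse_le_ln:
  "n \<ge> 1 \<Longrightarrow> (\<Sum>m=1..n. 1 / real m) \<le> 1 + ln (real n)"
proof (induction n rule: dec_induct)
  case (step n)
  have "ln (real n / real (Suc n)) \<le> real n / real (Suc n) - 1"
    using step by (intro ln_le_minus_one) auto
  moreover have "real n / real (Suc n) - 1 = - (1 / real (Suc n))" by (simp add: field_simps)
  ultimately have "1 / real (Suc n) \<le> ln (real (Suc n)) - ln (real n)"
    using step by (simp add: ln_div)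
  then show ?case using step by simp
qed simp

text \<open>Young's inequality, standing in for Hoelder's; below \<open>P = p powr (3/4)\<close> is the size of \<open>k\<close>.\<close>

lemma mult_le_powr_four_thirds_plus_pow4:
  fixes w k P :: real
  assumes "w > 0" "k \<ge> 0" "P > 0"
  shows "w * k \<le> 3 / 4 * P * w powr (4/3) + k ^ 4 / (4 * P ^ 3)"
proof (cases "k = 0")
  case False
  with assms have k: "k > 0" by simp
  \<comment> \<open>In this weighted geometric mean the powers of \<open>P\<close> cancel, so
    \<open>P\<close> is free to balance the two terms.\<close>
  have "(P * w powr (4/3)) powr (3/4) * (k ^ 4 / P ^ 3) powr (1/4)
      \<le> 3/4 * (P * w powr (4/3)) + 1/4 * (k ^ 4 / P ^ 3)"
    using assms k by (intro Youngs_inequality_0) auto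
  moreover have "(P * w powr (4/3)) powr (3/4) * (k ^ 4 / P ^ 3) powr (1/4) = w * k"
  proof -
    have "(k ^ 4) powr (1/4) = (k powr 4) powr (1/4)" using k by simp
    also have "\<dots> = k" using k by (simp only: powr_powr) simp
    finally have k4: "(k ^ 4) powr (1/4) = k" .
    have "(P ^ 3) powr (1/4) = (P powr 3) powr (1/4)" using assms by simp
    also have "\<dots> = P powr (3/4)" by (simp only: powr_powr) simp
    finally have P3: "(P ^ 3) powr (1/4) = P powr (3/4)" .
    show ?thesis
      using assms k by (simp add: powr_mult powr_divide powr_powr k4 P3)
  qed
  ultimately show ?thesis by simp
qed (use assms in simp)

text \<open>Doubling keeps the arithmetic series in the integers. For \<open>A = B + 1\<close> the
  interval is empty and both sides vanish.\<close>

lemma sum_affine_interval: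
  fixes A B c d :: int
  assumes "A \<le> B + 1"
  shows "2 * (\<Sum>x\<in>{A..B}. c * x + d) = (B + 1 - A) * (c * (A + B) + 2 * d)"
proof -
  have "2 * (\<Sum>x\<in>{A..A + int n - 1}. c * x + d) = int n * (c * (2 * A + int n - 1) + 2 * d)" for n
  proof (induction n)
    case (Suc n)
    have "{A..A + int (Suc n) - 1} = insert (A + int n) {A..A + int n - 1}" by auto
    then show ?case using Suc by (simp add: algebra_simps)
  qed simp
  from this[of "nat (B + 1 - A)"] assms show ?thesis by (simp add: algebra_simps)
qed

section \<open>Additive characters modulo \<open>p\<close>\<close>

locale prime_modulus =
  fixes p :: nat
  assumes prime_p: "prime p"
begin

definition e :: "int \<Rightarrow> complex" where
  "e k = cis (2 * pi * of_int k / of_nat p)"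

lemma p_gt_1: "int p > 1"
  using prime_gt_1_nat[OF prime_p] by simp

lemma p_pos: "real p > 0"
  using p_gt_1 by simp

lemma e_0 [simp]: "e 0 = 1"
  by (simp add: e_def)

lemma e_add: "e (a + b) = e a * e b"
  by (simp add: e_def cis_mult add_divide_distrib distrib_left)

lemma norm_e [simp]: "norm (e a) = 1"
  by (simp add: e_def)

lemma cnj_e: "cnj (e a) = e (- a)"
  by (simp add: e_def cis_cnj)

lemma e_multiple [simp]: "e (int p * k) = 1"
proof -
  have "2 * pi * of_int (int p * k) / of_nat p = 2 * pi * of_int k"
    using p_pos by simp
  then show ?thesis by (simp add: e_def)
qed

lemma e_mod [simp]: "e (a mod int p) = e a"
proof -
  have "e a = e (a mod int p + int p * (a div int p))" by simp
  also have "\<dots> = e (a mod int p)" by (simp only: e_add e_multiple mult_1_right)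
  finally show ?thesis by simp
qed

lemma e_cong:
  assumes "[a = b] (mod int p)"
  shows "e a = e b"
proof -
  have "e a = e (a mod int p)" by simp
  also have "\<dots> = e (b mod int p)" using assms by (simp only: Cong.cong_def)
  finally show ?thesis by simp
qed

text \<open>The chord from 1 to \<open>e b\<close> has length \<open>2 * sin (pi * b / p)\<close>.
  Jordan's inequality applies while \<open>2 * b \<le> p\<close>; reflecting \<open>b\<close> to
  \<open>p - b\<close> gives the other half.\<close>

lemma norm_e_minus_1_ge:
  assumes "b \<in> {1..<int p}"
  shows "norm (e b - 1) \<ge> 4 * real_of_int (min b (int p - b)) / real p"
proof -
  let ?t = "\<lambda>c. pi * real_of_int c / real p"
  have *: "norm (e b - 1) = 2 * sin (?t b)"
  proof -
    have "norm (e b - 1) = 2 * \<bar>sin (2 * pi * of_int b / of_nat p / 2)\<bar>"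
      unfolding e_def cis_conv_exp using dist_exp_i_1[of "2 * pi * of_int b / of_nat p"] by simp
    moreover have "sin (?t b) \<ge> 0"
      using assms p_pos by (intro sin_ge_zero) (auto simp: field_simps)
    ultimately show ?thesis by simp
  qed
  have jordan: "4 * real_of_int c / real p \<le> 2 * sin (?t c)" if "0 \<le> c" "2 * c \<le> int p" for c
    using sin_ge_two_div_pi[of "?t c"] that p_pos by (auto simp: field_simps)
  show ?thesis
  proof (cases "2 * b \<le> int p")
    case True
    then show ?thesis using jordan[of b] assms * by (simp add: min_def)
  next
    case False
    have "?t b = pi - ?t (int p - b)" using p_pos by (simp add: field_simps)
    then have "sin (?t b) = sin (?t (int p - b))" by simp
    then show ?thesis using jordan[of "int p - b"] False assms * by (simp add: min_def)
  qed
qed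

lemma e_eq_1_iff: "e k = 1 \<longleftrightarrow> int p dvd k"
proof
  assume "e k = 1"
  show "int p dvd k"
  proof (rule ccontr)
    assume "\<not> int p dvd k"
    moreover have "0 \<le> k mod int p" "k mod int p < int p"
      using p_gt_1 by simp_all
    ultimately have k: "k mod int p \<in> {1..<int p}"
      unfolding dvd_eq_mod_eq_0 atLeastLessThan_iff by linarith
    then have "0 < 4 * real_of_int (min (k mod int p) (int p - k mod int p)) / real p"
      using p_pos by (intro divide_pos_pos) auto
    with norm_e_minus_1_ge[OF k] \<open>e k = 1\<close> show False by simp
  qed
next
  assume "int p dvd k"
  then obtain q where "k = int p * q" by (rule dvdE)
  then show "e k = 1" by (simp only: e_multiple)
qed

text \<open>The geometric series with its denominator multiplied out, hence valid also when
  \<open>e b = 1\<close>.\<close>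

lemma e_interval_sum:
  assumes "A \<le> B + 1"
  shows "(e b - 1) * (\<Sum>z\<in>{A..B}. e (b * z)) = e (b * (B + 1)) - e (b * A)"
proof -
  have "(e b - 1) * (\<Sum>z\<in>{A..A + int n - 1}. e (b * z)) = e (b * (A + int n)) - e (b * A)" for n
  proof (induction n)
    case (Suc n)
    have "{A..A + int (Suc n) - 1} = insert (A + int n) {A..A + int n - 1}" by auto
    then show ?case using Suc by (simp add: algebra_simps e_add)
  qed simp
  from this[of "nat (B + 1 - A)"] assms show ?thesis by simp
qed

lemma norm_e_interval_sum_le:
  assumes "b \<in> {1..<int p}"
  shows "norm (\<Sum>z\<in>{A..B}. e (b * z)) \<le> real p / (2 * real_of_int (min b (int p - b)))"
proof (cases "A \<le> B + 1")
  case True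
  let ?S = "\<Sum>z\<in>{A..B}. e (b * z)" and ?m = "real_of_int (min b (int p - b))"
  have m: "?m > 0" using assms by auto
  have "4 * ?m / real p * norm ?S \<le> norm (e b - 1) * norm ?S"
    using norm_e_minus_1_ge[OF assms] by (intro mult_right_mono) auto
  also have "\<dots> = norm (e (b * (B + 1)) - e (b * A))"
    using e_interval_sum[OF True, of b] by (simp flip: norm_mult)
  also have "\<dots> \<le> 2" using norm_triangle_ineq4[of "e (b * (B + 1))" "e (b * A)"] by simp
  finally show ?thesis using m p_pos by (simp add: field_simps)
next
  case False
  then show ?thesis using assms by auto
qed

text \<open>Orthogonality: over a full period the two end terms of the geometric series agree, so it
  vanishes unless its ratio \<open>e k\<close> is 1.\<close>

lemma sum_e_mult:
  "(\<Sum>a\<in>{0..<int p}. e (a * k)) = (if int p dvd k then of_nat p else 0)"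
proof (cases "int p dvd k")
  case True
  then have "e (a * k) = 1" for a by (simp add: e_eq_1_iff)
  then show ?thesis using True by simp
next
  case False
  have "{0..<int p} = {0..int p - 1}" by auto
  then have "(e k - 1) * (\<Sum>a\<in>{0..<int p}. e (k * a)) = 0"
    using e_interval_sum[of 0 "int p - 1" k] p_gt_1 by (simp add: mult.commute[of k])
  then show ?thesis using False by (simp add: e_eq_1_iff mult.commute)
qed

text \<open>Parseval in two variables: expanding the square gives a sum over pairs, and
  orthogonality in \<open>a\<close> and in \<open>b\<close> keeps the pairs congruent under both
  \<open>f\<close> and \<open>g\<close>.\<close>

lemma sum_cmod_square_e:
  fixes f g :: "'a \<Rightarrow> int"
  assumes "finite S"
  shows "(\<Sum>a\<in>{0..<int p}. \<Sum>b\<in>{0..<int p}. (cmod (\<Sum>s\<in>S. e (a * f s + b * g s)))\<^sup>2) =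
    (real p)\<^sup>2 * real (card {(s, t). s \<in> S \<and> t \<in> S \<and> [f s = f t] (mod int p) \<and> [g s = g t] (mod int p)})"
proof -
  let ?P = "\<lambda>s t. [f s = f t] (mod int p) \<and> [g s = g t] (mod int p)"
  have "complex_of_real (\<Sum>a\<in>{0..<int p}. \<Sum>b\<in>{0..<int p}. (cmod (\<Sum>s\<in>S. e (a * f s + b * g s)))\<^sup>2) =
    (\<Sum>a\<in>{0..<int p}. \<Sum>b\<in>{0..<int p}. \<Sum>s\<in>S. \<Sum>t\<in>S. e (a * (f s - f t)) * e (b * (g s - g t)))"
    by (simp only: of_real_sum complex_norm_square cnj_sum sum_product cnj_e e_add [symmetric])
      (simp add: algebra_simps)
  also have "\<dots> = (\<Sum>s\<in>S. \<Sum>t\<in>S. \<Sum>a\<in>{0..<int p}. \<Sum>b\<in>{0..<int p}. e (a * (f s - f t)) * e (b * (g s - g t)))"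
    (is "(\<Sum>a\<in>?R. \<Sum>b\<in>?R. \<Sum>s\<in>S. \<Sum>t\<in>S. ?F a b s t) = _")
  proof -
    have "(\<Sum>a\<in>?R. \<Sum>b\<in>?R. \<Sum>s\<in>S. \<Sum>t\<in>S. ?F a b s t) =
        (\<Sum>a\<in>?R. \<Sum>s\<in>S. \<Sum>b\<in>?R. \<Sum>t\<in>S. ?F a b s t)"
      by (intro sum.cong refl sum.swap)
    also have "\<dots> = (\<Sum>s\<in>S. \<Sum>a\<in>?R. \<Sum>b\<in>?R. \<Sum>t\<in>S. ?F a b s t)"
      by (rule sum.swap)
    also have "\<dots> = (\<Sum>s\<in>S. \<Sum>a\<in>?R. \<Sum>t\<in>S. \<Sum>b\<in>?R. ?F a b s t)"
      by (intro sum.cong refl sum.swap)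
    also have "\<dots> = (\<Sum>s\<in>S. \<Sum>t\<in>S. \<Sum>a\<in>?R. \<Sum>b\<in>?R. ?F a b s t)"
      by (intro sum.cong refl sum.swap)
    finally show ?thesis .
  qed
  also have "\<dots> = (\<Sum>s\<in>S. \<Sum>t\<in>S. (\<Sum>a\<in>{0..<int p}. e (a * (f s - f t))) * (\<Sum>b\<in>{0..<int p}. e (b * (g s - g t))))"
    by (simp add: sum_product)
  also have "\<dots> = (\<Sum>s\<in>S. \<Sum>t\<in>S. if ?P s t then (of_nat p)\<^sup>2 else 0)"
    by (intro sum.cong refl) (simp add: sum_e_mult cong_iff_dvd_diff power2_eq_square)
  also have "\<dots> = (\<Sum>(s, t)\<in>S \<times> S. if ?P s t then (of_nat p)\<^sup>2 else 0)"
    by (simp add: sum.cartesian_product)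
  also have "\<dots> = (\<Sum>(s, t)\<in>{(s, t). s \<in> S \<and> t \<in> S \<and> ?P s t}. (of_nat p)\<^sup>2)"
    by (intro sum.mono_neutral_cong_right) (use assms in \<open>auto split: if_splits\<close>)
  finally have "complex_of_real (\<Sum>a\<in>{0..<int p}. \<Sum>b\<in>{0..<int p}. (cmod (\<Sum>s\<in>S. e (a * f s + b * g s)))\<^sup>2) =
    complex_of_real ((real p)\<^sup>2 * real (card {(s, t). s \<in> S \<and> t \<in> S \<and> ?P s t}))"
    by (simp add: case_prod_unfold mult.commute)
  then show ?thesis unfolding of_real_eq_iff .
qed

section \<open>Inverses and residues modulo \<open>p\<close>\<close>

lemma inv_mod_range: "x \<in> {1..<int p} \<Longrightarrow> inv_mod p x \<in> {1..<int p}"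
  and inv_mod_cong: "x \<in> {1..<int p} \<Longrightarrow> [x * inv_mod p x = 1] (mod int p)"
proof -
  assume x: "x \<in> {1..<int p}"
  then have cop: "coprime x (int p)"
    using prime_p by (intro prime_imp_coprime_int[THEN coprime_commute[THEN iffD1]]) (auto dest: zdvd_imp_le)
  have eq: "inv_mod p x = modular_inverse (int p) x"
    using x by (intro inv_mod_eq_modular_inverse prime_p) auto
  show "inv_mod p x \<in> {1..<int p}"
    using mult_modular_inverse_int_pos[OF p_gt_1 cop] modular_inverse_int_less[of "int p" x] p_gt_1
    by (simp add: eq)
  show "[x * inv_mod p x = 1] (mod int p)"
    unfolding eq by (rule cong_modular_inverse1[OF cop])
qed

lemma inv_mod_eqI:
  assumes "x \<in> {1..<int p}" "y \<in> {1..<int p}" "[x * y = 1] (mod int p)"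
  shows "inv_mod p x = y"
  using assms modular_inverse_int_eqI[of y "int p" x]
  by (subst inv_mod_eq_modular_inverse[OF prime_p]) auto

lemma inv_mod_inv_mod: "x \<in> {1..<int p} \<Longrightarrow> inv_mod p (inv_mod p x) = x"
  using inv_mod_range[of x] inv_mod_cong[of x] by (intro inv_mod_eqI) (auto simp: mult.commute)

lemma bij_betw_mult_mod: "a \<in> {1..<int p} \<Longrightarrow> bij_betw (\<lambda>x. a * x mod int p) {1..<int p} {1..<int p}"
  using inv_mod_cong[of a] by (intro bij_betw_int_remainders_mult) (auto simp: coprime_iff_invertible_int)

text \<open>The product of \<open>a * x\<close>, its inverse and the inverse of \<open>x\<close> is
  computed in two ways, cancelling either inverse first.\<close>

lemma inv_mod_mult_mod:
  assumes "a \<in> {1..<int p}" "x \<in> {1..<int p}"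
  shows "[a * inv_mod p (a * x mod int p) = inv_mod p x] (mod int p)"
proof -
  let ?y = "a * x mod int p"
  have y: "?y \<in> {1..<int p}" using bij_betw_mult_mod[OF assms(1)] assms(2) by (auto dest: bij_betwE)
  have "[a * x * inv_mod p ?y = 1] (mod int p)"
    using inv_mod_cong[OF y] by (simp add: Cong.cong_def mod_mult_left_eq)
  then have "[a * x * inv_mod p ?y * inv_mod p x = 1 * inv_mod p x] (mod int p)"
    by (intro cong_mult cong_refl)
  moreover have "[x * inv_mod p x * (a * inv_mod p ?y) = 1 * (a * inv_mod p ?y)] (mod int p)"
    using inv_mod_cong[OF assms(2)] by (intro cong_mult cong_refl)
  ultimately show ?thesis by (simp add: mult_ac) (metis cong_sym cong_trans)
qed

lemma sum_periodic_shift: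
  fixes F :: "int \<Rightarrow> 'a::comm_monoid_add"
  assumes "\<And>k. F (k mod int p) = F k"
  shows "(\<Sum>b\<in>{0..<int p}. F (h + b)) = (\<Sum>b\<in>{0..<int p}. F b)"
proof -
  have "bij_betw (\<lambda>b. (h + b) mod int p) {0..<int p} {0..<int p}"
  proof (intro bij_betwI[of _ _ _ "\<lambda>b. (b - h) mod int p"])
    show "((h + b) mod int p - h) mod int p = b" if "b \<in> {0..<int p}" for b
      using that by (simp add: mod_diff_left_eq)
    show "(h + (b - h) mod int p) mod int p = b" if "b \<in> {0..<int p}" for b
      using that by (simp add: mod_add_right_eq)
  qed (use p_gt_1 in auto)
  from sum.reindex_bij_betw[OF this, of F] show ?thesis by (simp add: assms)
qed

lemma sum_residues_eq: "(\<Sum>b\<in>{0..<int p}. F b) = F 0 + (\<Sum>b\<in>{1..<int p}. F b)"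
  for F :: "int \<Rightarrow> 'a::comm_monoid_add"
proof -
  have "{0..<int p} = insert 0 {1..<int p}" using p_gt_1 by auto
  then show ?thesis by simp
qed

lemma sum_periodic_mult:
  fixes F :: "int \<Rightarrow> 'a::comm_monoid_add"
  assumes "\<And>k. F (k mod int p) = F k" "a \<in> {1..<int p}"
  shows "(\<Sum>b\<in>{0..<int p}. F (a * b)) = (\<Sum>b\<in>{0..<int p}. F b)"
  using sum.reindex_bij_betw[OF bij_betw_mult_mod[OF assms(2)], of F]
  by (simp add: sum_residues_eq assms)

section \<open>Kloosterman sums and their fourth moment\<close>

definition kloosterman :: "int \<Rightarrow> int \<Rightarrow> complex" where
  "kloosterman a b = (\<Sum>x\<in>{1..<int p}. e (a * inv_mod p x + b * x))"

lemma kloosterman_mod [simp]: "kloosterman a (b mod int p) = kloosterman a b"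
  unfolding kloosterman_def
  by (intro sum.cong refl e_cong cong_add cong_mult) (auto simp: Cong.cong_def)

text \<open>Substituting \<open>a * x mod p\<close> for \<open>x\<close>, which permutes the nonzero
  residues, moves the factor \<open>a\<close> from the inverse to the linear term.\<close>

lemma kloosterman_mult:
  assumes "a \<in> {1..<int p}"
  shows "kloosterman a b = kloosterman 1 (a * b)"
proof -
  have "kloosterman a b = (\<Sum>x\<in>{1..<int p}. e (a * inv_mod p (a * x mod int p) + b * (a * x mod int p)))"
    unfolding kloosterman_def by (rule sum.reindex_bij_betw[OF bij_betw_mult_mod[OF assms], symmetric])
  also have "\<dots> = kloosterman 1 (a * b)"
    unfolding kloosterman_def
  proof (intro sum.cong refl e_cong cong_add)
    fix x assume "x \<in> {1..<int p}"
    then show "[a * inv_mod p (a * x mod int p) = 1 * inv_mod p x] (mod int p)"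
      using inv_mod_mult_mod[OF assms] by simp
    show "[b * (a * x mod int p) = a * b * x] (mod int p)"
      by (simp add: Cong.cong_def mod_mult_right_eq mult_ac)
  qed
  finally show ?thesis .
qed

lemma residue_eq_if_dvd: "x \<in> {1..<int p} \<Longrightarrow> y \<in> {1..<int p} \<Longrightarrow> int p dvd x - y \<Longrightarrow> x = y"
  by (metis atLeastLessThan_iff cong_iff_dvd_diff cong_less_imp_eq_int zero_le_one order_trans)

lemma residue_eq_minus_if_dvd:
  assumes "x \<in> {1..<int p}" "y \<in> {1..<int p}" "int p dvd x + y"
  shows "y = int p - x"
proof -
  have "int p dvd y - (int p - x)"
    using dvd_diff[OF assms(3) dvd_refl] by (simp add: algebra_simps)
  then show ?thesis using assms by (intro residue_eq_if_dvd) auto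
qed

text \<open>If \<open>x + y\<close> vanishes modulo \<open>p\<close>, so does \<open>z + w\<close>,
  which is the third alternative. Otherwise clearing denominators and cancelling
  \<open>x + y\<close> shows that the pairs also have equal products, so they are the roots of one
  quadratic.\<close>

lemma pair_sums_and_inverses:
  assumes U: "x \<in> {1..<int p}" "y \<in> {1..<int p}" "z \<in> {1..<int p}" "w \<in> {1..<int p}"
    and inverses: "[inv_mod p x + inv_mod p y = inv_mod p z + inv_mod p w] (mod int p)"
    and sums: "[x + y = z + w] (mod int p)"
  shows "x = z \<and> y = w \<or> x = w \<and> y = z \<or> y = int p - x \<and> w = int p - z"
proof (cases "int p dvd x + y")
  case True
  then have "int p dvd z + w" using sums by (simp add: cong_dvd_iff)
  with True show ?thesis using U residue_eq_minus_if_dvd by blast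
next
  case False
  have clear: "[(inv_mod p x + inv_mod p y) * (x * y * k) = (x + y) * k] (mod int p)"
    if "x \<in> {1..<int p}" "y \<in> {1..<int p}" for x y k
  proof -
    have "int p dvd x * inv_mod p x - 1" "int p dvd y * inv_mod p y - 1"
      using inv_mod_cong that by (simp_all add: cong_iff_dvd_diff)
    then have "int p dvd (x * inv_mod p x - 1) * (y * k) + (y * inv_mod p y - 1) * (x * k)"
      by (intro dvd_add dvd_mult2)
    then show ?thesis by (simp add: cong_iff_dvd_diff algebra_simps)
  qed
  have "[(x + y) * (z * w) = (inv_mod p x + inv_mod p y) * (x * y * (z * w))] (mod int p)"
    using clear U by (blast intro: cong_sym)
  also have "[(inv_mod p x + inv_mod p y) * (x * y * (z * w)) =
      (inv_mod p z + inv_mod p w) * (z * w * (x * y))] (mod int p)"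
    using cong_scalar_right[OF inverses, of "x * y * (z * w)"] by (simp add: mult_ac)
  also have "[(inv_mod p z + inv_mod p w) * (z * w * (x * y)) = (z + w) * (x * y)] (mod int p)"
    using clear U by blast
  also have "[(z + w) * (x * y) = (x + y) * (x * y)] (mod int p)"
    using sums by (intro cong_scalar_right) (rule cong_sym)
  finally have "int p dvd (x + y) * (z * w - x * y)"
    by (simp add: cong_iff_dvd_diff algebra_simps)
  then have "int p dvd z * w - x * y"
    using False prime_p by (auto simp: prime_dvd_mult_iff)
  \<comment> \<open>This is the value at \<open>x\<close> of the quadratic with roots
    \<open>z\<close> and \<open>w\<close>.\<close>
  then have "int p dvd x * (x + y - (z + w)) + (z * w - x * y)"
    using sums by (intro dvd_add dvd_mult) (simp_all add: cong_iff_dvd_diff)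
  then have "int p dvd (x - z) * (x - w)" by (simp add: algebra_simps)
  then have "x = z \<or> x = w"
    using prime_p U residue_eq_if_dvd by (auto simp: prime_dvd_mult_iff)
  then show ?thesis
  proof
    assume "x = z"
    then show ?thesis using sums U residue_eq_if_dvd[of y w] by (simp add: cong_iff_dvd_diff)
  next
    assume "x = w"
    then show ?thesis using sums U residue_eq_if_dvd[of y z] by (simp add: cong_iff_dvd_diff)
  qed
qed

text \<open>The square of a Kloosterman sum is a character sum over pairs, so Parseval turns the
  fourth moment into \<open>p\<^sup>2\<close> times a number of solutions. These lie in three
  families, each parametrised by \<open>(p - 1)\<^sup>2\<close> pairs.\<close>

lemma sum_kloosterman_pow4_le_all:
  "(\<Sum>a\<in>{0..<int p}. \<Sum>b\<in>{0..<int p}. cmod (kloosterman a b) ^ 4) \<le> 3 * (real p)\<^sup>2 * (real p - 1)\<^sup>2"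
proof -
  let ?S = "{1..<int p} \<times> {1..<int p}"
  define f g where "f = (\<lambda>(x, y). inv_mod p x + inv_mod p y)" and "g = (\<lambda>(x, y). x + y :: int)"
  let ?N = "{(s, t). s \<in> ?S \<and> t \<in> ?S \<and> [f s = f t] (mod int p) \<and> [g s = g t] (mod int p)}"
  have "cmod (kloosterman a b) ^ 4 = (cmod (\<Sum>s\<in>?S. e (a * f s + b * g s)))\<^sup>2" for a b
  proof -
    have "(kloosterman a b)\<^sup>2 = (\<Sum>s\<in>?S. e (a * f s + b * g s))"
      unfolding kloosterman_def power2_eq_square sum_product sum.cartesian_product
      by (intro sum.cong refl) (auto simp: f_def g_def algebra_simps simp flip: e_add)
    moreover have "cmod (kloosterman a b) ^ 4 = (cmod ((kloosterman a b)\<^sup>2))\<^sup>2"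
      by (simp add: norm_power flip: power_mult)
    ultimately show ?thesis by simp
  qed
  then have "(\<Sum>a\<in>{0..<int p}. \<Sum>b\<in>{0..<int p}. cmod (kloosterman a b) ^ 4) = (real p)\<^sup>2 * real (card ?N)"
    by (simp add: sum_cmod_square_e)
  also have "real (card ?N) \<le> 3 * (real p - 1)\<^sup>2"
  proof -
    let ?A = "(\<lambda>s. (s, s)) ` ?S" and ?B = "(\<lambda>(x, y). ((x, y), (y, x))) ` ?S"
      and ?C = "(\<lambda>(x, z). ((x, int p - x), (z, int p - z))) ` ?S"
    have "?N \<subseteq> ?A \<union> ?B \<union> ?C"
    proof
      fix q assume "q \<in> ?N"
      then obtain x y z w where q: "q = ((x, y), (z, w))"
        and U: "x \<in> {1..<int p}" "y \<in> {1..<int p}" "z \<in> {1..<int p}" "w \<in> {1..<int p}"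
        and *: "[inv_mod p x + inv_mod p y = inv_mod p z + inv_mod p w] (mod int p)"
          "[x + y = z + w] (mod int p)"
        by (auto simp: f_def g_def)
      consider "x = z" "y = w" | "x = w" "y = z" | "y = int p - x" "w = int p - z"
        using pair_sums_and_inverses[OF U *] by blast
      then show "q \<in> ?A \<union> ?B \<union> ?C"
      proof cases
        case 1
        then have "q \<in> ?A" using q U by blast
        then show ?thesis by blast
      next
        case 2
        then have "q \<in> ?B" using q U by (intro image_eqI[of _ _ "(x, y)"]) auto
        then show ?thesis by blast
      next
        case 3
        then have "q \<in> ?C" using q U by (intro image_eqI[of _ _ "(x, z)"]) auto
        then show ?thesis by blast
      qed
    qed
    then have "card ?N \<le> card (?A \<union> ?B \<union> ?C)" by (intro card_mono) auto
    also have "\<dots> \<le> card ?A + card ?B + card ?C"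
      by (meson add_le_mono card_Un_le le_refl order_trans)
    also have "\<dots> \<le> card ?S + card ?S + card ?S" by (intro add_mono card_image_le) auto
    finally have "real (card ?N) \<le> 3 * real (card ?S)" by linarith
    moreover have "real (card ?S) = (real p - 1)\<^sup>2"
      using p_gt_1 by (simp add: power2_eq_square)
    ultimately show ?thesis by simp
  qed
  finally show ?thesis using p_pos by (simp add: mult_ac)
qed

lemma sum_kloosterman_pow4_le:
  assumes "a \<in> {1..<int p}"
  shows "(\<Sum>b\<in>{0..<int p}. cmod (kloosterman a (h + b)) ^ 4) \<le> 3 * real p ^ 3"
proof -
  let ?T = "\<Sum>b\<in>{0..<int p}. cmod (kloosterman 1 b) ^ 4"
  have eq: "(\<Sum>b\<in>{0..<int p}. cmod (kloosterman a b) ^ 4) = ?T" if "a \<in> {1..<int p}" for a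
    using sum_periodic_mult[of "\<lambda>b. cmod (kloosterman 1 b) ^ 4", OF _ that]
    by (simp add: kloosterman_mult[OF that])
  have "(real p - 1) * ?T = (\<Sum>a\<in>{1..<int p}. ?T)"
    using p_gt_1 by simp
  also have "\<dots> = (\<Sum>a\<in>{1..<int p}. \<Sum>b\<in>{0..<int p}. cmod (kloosterman a b) ^ 4)"
    by (intro sum.cong refl eq [symmetric])
  \<comment> \<open>The nonnegative row \<open>a = 0\<close> is added to reach the complete
    moment.\<close>
  also have "\<dots> \<le> (\<Sum>a\<in>{0..<int p}. \<Sum>b\<in>{0..<int p}. cmod (kloosterman a b) ^ 4)"
    by (intro sum_mono2) (auto intro!: sum_nonneg)
  also have "\<dots> \<le> (real p - 1) * (3 * (real p)\<^sup>2 * (real p - 1))"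
    using sum_kloosterman_pow4_le_all by (simp add: power2_eq_square mult_ac)
  finally have "?T \<le> 3 * (real p)\<^sup>2 * (real p - 1)" using p_gt_1 by simp
  also have "\<dots> \<le> 3 * (real p)\<^sup>2 * real p" by (intro mult_left_mono) auto
  also have "\<dots> = 3 * real p ^ 3" by (simp add: power2_eq_square power3_eq_cube)
  also have "?T = (\<Sum>b\<in>{0..<int p}. cmod (kloosterman a b) ^ 4)" using eq[OF assms] by simp
  also have "\<dots> = (\<Sum>b\<in>{0..<int p}. cmod (kloosterman a (h + b)) ^ 4)"
    by (rule sum_periodic_shift[symmetric]) simp
  finally show ?thesis .
qed

section \<open>Incomplete sums over intervals\<close>

text \<open>The minimum is one of \<open>b\<close> and \<open>p - b\<close>; adding the nonnegative
  value at the other one makes the sum symmetric, whence the factor 2.\<close>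

lemma sum_min_residue_le:
  fixes f :: "int \<Rightarrow> real"
  assumes "\<And>m. m \<in> {1..<int p} \<Longrightarrow> f m \<ge> 0"
  shows "(\<Sum>b\<in>{1..<int p}. f (min b (int p - b))) \<le> 2 * (\<Sum>m=1..p - 1. f (int m))"
proof -
  have "(\<Sum>b\<in>{1..<int p}. f (min b (int p - b))) \<le> (\<Sum>b\<in>{1..<int p}. f b + f (int p - b))"
    using assms by (intro sum_mono) (auto simp: min_def)
  also have "\<dots> = (\<Sum>b\<in>{1..<int p}. f b) + (\<Sum>b\<in>{1..<int p}. f (int p - b))"
    by (rule sum.distrib)
  also have "(\<Sum>b\<in>{1..<int p}. f (int p - b)) = (\<Sum>b\<in>{1..<int p}. f b)"
    by (rule sum.reindex_bij_witness[of _ "\<lambda>b. int p - b" "\<lambda>b. int p - b"]) auto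
  also have "(\<Sum>b\<in>{1..<int p}. f b) = (\<Sum>m=1..p - 1. f (int m))"
    using p_gt_1 by (intro sum.reindex_bij_witness[of _ int nat]) auto
  finally show ?thesis by simp
qed

text \<open>Summing over \<open>b\<close> first leaves \<open>e (b * (x - z))\<close>, and
  orthogonality selects \<open>x = z\<close>, since both are residues in
  \<open>{1..<int p}\<close>.\<close>

lemma completed_sum:
  assumes "{A..B} \<subseteq> {1..<int p}"
  shows "of_nat p * (\<Sum>x\<in>{A..B}. e (a * inv_mod p x + h * x)) =
    (\<Sum>b\<in>{0..<int p}. cnj (\<Sum>z\<in>{A..B}. e (b * z)) * kloosterman a (h + b))"
proof -
  let ?g = "\<lambda>x. e (a * inv_mod p x + h * x)"
  have "(\<Sum>b\<in>{0..<int p}. cnj (\<Sum>z\<in>{A..B}. e (b * z)) * kloosterman a (h + b)) =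
      (\<Sum>b\<in>{0..<int p}. \<Sum>z\<in>{A..B}. \<Sum>x\<in>{1..<int p}. ?g x * e (b * (x - z)))"
    unfolding kloosterman_def cnj_sum sum_product cnj_e
    by (intro sum.cong refl) (simp add: algebra_simps flip: e_add)
  also have "\<dots> = (\<Sum>z\<in>{A..B}. \<Sum>b\<in>{0..<int p}. \<Sum>x\<in>{1..<int p}. ?g x * e (b * (x - z)))"
    by (rule sum.swap)
  also have "\<dots> = (\<Sum>z\<in>{A..B}. \<Sum>x\<in>{1..<int p}. \<Sum>b\<in>{0..<int p}. ?g x * e (b * (x - z)))"
    by (intro sum.cong refl sum.swap)
  also have "\<dots> = (\<Sum>z\<in>{A..B}. \<Sum>x\<in>{1..<int p}. if x = z then of_nat p * ?g z else 0)"
    unfolding sum_distrib_left [symmetric] sum_e_mult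
    using assms residue_eq_if_dvd by (intro sum.cong refl) auto
  also have "\<dots> = (\<Sum>z\<in>{A..B}. of_nat p * ?g z)"
    using assms by (intro sum.cong refl) auto
  finally show ?thesis by (simp add: sum_distrib_left)
qed

lemma incomplete_kloosterman_le:
  assumes a: "a \<in> {1..<int p}" and I: "{A..B} \<subseteq> {1..<int p}"
  shows "cmod (\<Sum>x\<in>{A..B}. e (a * inv_mod p x + h * x)) \<le> 9 / 2 * real p powr (3/4)"
proof -
  define P where "P = real p powr (3/4)"
  have P: "P > 0" "P ^ 4 = real p ^ 3"
    using p_pos by (simp_all add: P_def powr_realpow [symmetric] powr_powr del: powr_numeral)
  define w where "w = (\<lambda>b::int. if b = 0 then 1 else 1 / (2 * real_of_int (min b (int p - b))))"
  define k where "k = (\<lambda>b. cmod (kloosterman a (h + b)))"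
  have w_pos: "w b > 0" if "b \<in> {0..<int p}" for b
    using that by (auto simp: w_def)
  have coeff: "cmod (\<Sum>z\<in>{A..B}. e (b * z)) \<le> real p * w b" if "b \<in> {0..<int p}" for b
  proof (cases "b = 0")
    case True
    have "card {A..B} \<le> card {1..<int p}" using I by (intro card_mono) auto
    then show ?thesis using True p_gt_1 by (simp add: w_def)
  next
    case False
    then show ?thesis using norm_e_interval_sum_le[of b A B] that by (simp add: w_def)
  qed
  have "real p * cmod (\<Sum>x\<in>{A..B}. e (a * inv_mod p x + h * x)) =
      cmod (\<Sum>b\<in>{0..<int p}. cnj (\<Sum>z\<in>{A..B}. e (b * z)) * kloosterman a (h + b))"
    unfolding completed_sum[OF I, symmetric] by (simp add: norm_mult)
  also have "\<dots> \<le> (\<Sum>b\<in>{0..<int p}. real p * w b * k b)"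
    using coeff by (intro sum_norm_le) (auto simp: norm_mult k_def simp del: cnj_sum intro!: mult_right_mono)
  also have "\<dots> = real p * (\<Sum>b\<in>{0..<int p}. w b * k b)"
    by (simp add: sum_distrib_left mult.assoc)
  finally have "cmod (\<Sum>x\<in>{A..B}. e (a * inv_mod p x + h * x)) \<le> (\<Sum>b\<in>{0..<int p}. w b * k b)"
    using p_pos by simp
  also have "\<dots> \<le> (\<Sum>b\<in>{0..<int p}. 3 / 4 * P * w b powr (4/3) + k b ^ 4 / (4 * P ^ 3))"
    using w_pos P by (intro sum_mono mult_le_powr_four_thirds_plus_pow4) (auto simp: k_def)
  also have "\<dots> = 3 / 4 * P * (\<Sum>b\<in>{0..<int p}. w b powr (4/3)) + (\<Sum>b\<in>{0..<int p}. k b ^ 4) / (4 * P ^ 3)"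
    by (simp add: sum.distrib sum_distrib_left sum_divide_distrib)
  \<comment> \<open>The 5 is 1 from \<open>b = 0\<close> plus 4 from the other frequencies, and
    \<open>3 * P ^ 4 = 3 * p ^ 3\<close> is the fourth moment. Together
    \<open>15 / 4 + 3 / 4 = 9 / 2\<close>.\<close>
  also have "\<dots> \<le> 3 / 4 * P * 5 + 3 * P ^ 4 / (4 * P ^ 3)"
  proof (intro add_mono mult_left_mono divide_right_mono)
    have half: "(1 / 2 :: real) powr (4/3) \<le> 1 / 2"
      using powr_mono'[of 1 "4/3" "1 / 2 :: real"] by simp
    have "(\<Sum>b\<in>{1..<int p}. (1 / (2 * real_of_int (min b (int p - b)))) powr (4/3))
        \<le> 2 * (\<Sum>m=1..p - 1. (1 / (2 * real_of_int (int m))) powr (4/3))"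
      by (rule sum_min_residue_le) simp
    also have "(\<Sum>m=1..p - 1. (1 / (2 * real_of_int (int m))) powr (4/3)) =
        (1 / 2) powr (4/3) * (\<Sum>m=1..p - 1. real m powr (-(4/3)))"
      unfolding sum_distrib_left
      by (intro sum.cong refl) (simp add: powr_divide powr_mult powr_minus_divide)
    also have "\<dots> \<le> 1 / 2 * 4"
      using half sum_powr_neg_four_thirds_le by (intro mult_mono) (auto intro!: sum_nonneg)
    finally have "(\<Sum>b\<in>{1..<int p}. w b powr (4/3)) \<le> 4" by (simp add: w_def)
    then show "(\<Sum>b\<in>{0..<int p}. w b powr (4/3)) \<le> 5"
      by (simp add: sum_residues_eq w_def)
    show "(\<Sum>b\<in>{0..<int p}. k b ^ 4) \<le> 3 * P ^ 4"
      using sum_kloosterman_pow4_le[OF a, of h] by (simp add: k_def P)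
  qed (use P in auto)
  also have "\<dots> = 9 / 2 * P" using P(1) by (simp add: field_simps power_eq_if)
  finally show ?thesis by (simp add: P_def)
qed

section \<open>Inverses in a strip between two lines\<close>

text \<open>The character \<open>a = 0\<close> contributes the number of lattice points of the strip
  divided by \<open>p\<close>. For other \<open>a\<close> the integral slopes let the ends of each
  slice merge with the linear phase, leaving two incomplete Kloosterman sums.\<close>

lemma count_inverses_in_strip:
  assumes I: "{A..B} \<subseteq> {1..<int p}"
    and strip: "\<And>x. x \<in> {A..B} \<Longrightarrow>
      0 \<le> l\<^sub>1 * x + l\<^sub>0 \<and> l\<^sub>1 * x + l\<^sub>0 \<le> r\<^sub>1 * x + r\<^sub>0 + 1 \<and> r\<^sub>1 * x + r\<^sub>0 < int p"
  shows "\<bar>real (card {x \<in> {A..B}. l\<^sub>1 * x + l\<^sub>0 \<le> inv_mod p x \<and> inv_mod p x \<le> r\<^sub>1 * x + r\<^sub>0})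
      - of_int (\<Sum>x\<in>{A..B}. r\<^sub>1 * x + r\<^sub>0 + 1 - (l\<^sub>1 * x + l\<^sub>0)) / real p\<bar>
    \<le> 9 / 2 * real p powr (3/4) * (1 + ln (real p))"
proof -
  define M where "M = 9 / 2 * real p powr (3/4)"
  have M: "M \<ge> 0" by (simp add: M_def)
  define J where "J = (\<lambda>x. {l\<^sub>1 * x + l\<^sub>0..r\<^sub>1 * x + r\<^sub>0})"
  define D where "D = (\<lambda>a. \<Sum>x\<in>{A..B}. \<Sum>y\<in>J x. e (a * (inv_mod p x - y)))"
  let ?C = "{x \<in> {A..B}. inv_mod p x \<in> J x}"
  let ?S = "\<Sum>x\<in>{A..B}. r\<^sub>1 * x + r\<^sub>0 + 1 - (l\<^sub>1 * x + l\<^sub>0)"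
  have eq_if_dvd: "y = inv_mod p x" if "x \<in> {A..B}" "y \<in> J x" "int p dvd inv_mod p x - y" for x y
  proof -
    have "0 \<le> y" "y < int p" using strip[OF that(1)] that(2) by (auto simp: J_def)
    moreover have "0 \<le> inv_mod p x" "inv_mod p x < int p"
      using inv_mod_range[of x] I that(1) by auto
    ultimately show ?thesis
      using dvd_imp_le_int[OF _ that(3)] by fastforce
  qed
  have "(\<Sum>a\<in>{0..<int p}. D a) =
      (\<Sum>x\<in>{A..B}. \<Sum>a\<in>{0..<int p}. \<Sum>y\<in>J x. e (a * (inv_mod p x - y)))"
    unfolding D_def by (rule sum.swap)
  also have "\<dots> = (\<Sum>x\<in>{A..B}. \<Sum>y\<in>J x. \<Sum>a\<in>{0..<int p}. e (a * (inv_mod p x - y)))"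
    by (intro sum.cong refl sum.swap)
  also have "\<dots> = (\<Sum>x\<in>{A..B}. \<Sum>y\<in>J x. if y = inv_mod p x then of_nat p else 0)"
    unfolding sum_e_mult using eq_if_dvd by (intro sum.cong refl) auto
  also have "\<dots> = (\<Sum>x\<in>{A..B}. if inv_mod p x \<in> J x then of_nat p else 0)"
    by (intro sum.cong refl) (simp add: J_def)
  also have "\<dots> = (\<Sum>x\<in>?C. of_nat p)"
    by (intro sum.mono_neutral_cong_right) auto
  finally have sum_D: "(\<Sum>a\<in>{0..<int p}. D a) = of_nat (card ?C) * of_nat p" by simp
  have D_0: "D 0 = of_int ?S"
    unfolding D_def of_int_sum
  proof (intro sum.cong refl)
    fix x assume "x \<in> {A..B}"
    \<comment> \<open>The strip condition allows an empty slice only with length exactly 0, so the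
      affine length is correct throughout.\<close>
    then have "int (card (J x)) = r\<^sub>1 * x + r\<^sub>0 + 1 - (l\<^sub>1 * x + l\<^sub>0)"
      using strip[of x] by (simp add: J_def)
    from this[symmetric] show "(\<Sum>y\<in>J x. e (0 * (inv_mod p x - y))) =
        of_int (r\<^sub>1 * x + r\<^sub>0 + 1 - (l\<^sub>1 * x + l\<^sub>0))"
      by (simp only: mult_zero_left e_0 sum_constant of_int_of_nat_eq mult_1_right)
  qed
  have D_le: "cmod (D a) \<le> M * real p / 2 * (1 / real_of_int (min a (int p - a)))" if a: "a \<in> {1..<int p}" for a
  proof -
    let ?m = "real_of_int (min a (int p - a))"
    have m: "?m > 0" using a by auto
    let ?E = "\<lambda>h. \<Sum>x\<in>{A..B}. e (a * inv_mod p x + h * x)"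
    \<comment> \<open>The factor \<open>e (- a) - 1\<close> collapses the geometric series over each
      slice to its two ends.\<close>
    have "(e (- a) - 1) * D a =
        (\<Sum>x\<in>{A..B}. e (a * inv_mod p x) * ((e (- a) - 1) * (\<Sum>y\<in>J x. e (- a * y))))"
      unfolding D_def sum_distrib_left
      by (intro sum.cong refl) (simp add: algebra_simps flip: e_add)
    also have "\<dots> = (\<Sum>x\<in>{A..B}. e (a * inv_mod p x) *
        (e (- a * (r\<^sub>1 * x + r\<^sub>0 + 1)) - e (- a * (l\<^sub>1 * x + l\<^sub>0))))"
      using strip unfolding J_def by (intro sum.cong refl) (simp only: e_interval_sum)
    also have "\<dots> = ?E (- a * r\<^sub>1) * e (- a * (r\<^sub>0 + 1)) - ?E (- a * l\<^sub>1) * e (- a * l\<^sub>0)"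
      unfolding sum_distrib_right sum_subtractf [symmetric]
      by (intro sum.cong refl) (simp add: algebra_simps flip: e_add)
    finally have eq: "(e (- a) - 1) * D a = \<dots>" .
    have "4 * ?m / real p * cmod (D a) \<le> cmod (e a - 1) * cmod (D a)"
      using norm_e_minus_1_ge[OF a] by (intro mult_right_mono) auto
    also have "cmod (e a - 1) = cmod (cnj (e a - 1))" by (rule complex_mod_cnj [symmetric])
    also have "cnj (e a - 1) = e (- a) - 1" by (simp add: cnj_e)
    also have "cmod (e (- a) - 1) * cmod (D a) = cmod ((e (- a) - 1) * D a)"
      by (rule norm_mult [symmetric])
    also have "\<dots> \<le> cmod (?E (- a * r\<^sub>1) * e (- a * (r\<^sub>0 + 1))) + cmod (?E (- a * l\<^sub>1) * e (- a * l\<^sub>0))"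
      unfolding eq by (rule norm_triangle_ineq4)
    also have "\<dots> = cmod (?E (- a * r\<^sub>1)) + cmod (?E (- a * l\<^sub>1))"
      unfolding norm_mult norm_e by simp
    also have "\<dots> \<le> M + M"
      unfolding M_def by (intro add_mono incomplete_kloosterman_le a I)
    finally show ?thesis using m p_pos by (simp add: field_simps)
  qed
  have "\<bar>real p * real (card ?C) - of_int ?S\<bar> = cmod (of_real (real p * real (card ?C) - of_int ?S))"
    by (rule norm_of_real [symmetric])
  also have "complex_of_real (real p * real (card ?C) - of_int ?S) = (\<Sum>a\<in>{1..<int p}. D a)"
    using sum_D by (simp add: sum_residues_eq D_0 algebra_simps)
  also have "cmod \<dots> \<le> (\<Sum>a\<in>{1..<int p}. M * real p / 2 * (1 / real_of_int (min a (int p - a))))"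
    using D_le by (rule sum_norm_le)
  also have "\<dots> = M * real p / 2 * (\<Sum>a\<in>{1..<int p}. 1 / real_of_int (min a (int p - a)))"
    by (simp only: sum_distrib_left)
  also have "\<dots> \<le> M * real p / 2 * (2 * (\<Sum>m=1..p - 1. 1 / real_of_int (int m)))"
    using M by (intro mult_left_mono sum_min_residue_le) auto
  also have "\<dots> \<le> M * real p / 2 * (2 * (1 + ln (real p)))"
  proof (intro mult_left_mono)
    have "(\<Sum>m=1..p - 1. 1 / real m) \<le> 1 + ln (real (p - 1))"
      using p_gt_1 by (intro sum_inverse_le_ln) auto
    also have "\<dots> \<le> 1 + ln (real p)" using p_gt_1 by simp
    finally show "(\<Sum>m=1..p - 1. 1 / real_of_int (int m)) \<le> 1 + ln (real p)" by simp
  qed (use M in auto)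
  also have "\<dots> = real p * (M * (1 + ln (real p)))" by simp
  also have "real p * real (card ?C) - of_int ?S = real p * (real (card ?C) - of_int ?S / real p)"
    using p_pos by (simp add: right_diff_distrib)
  finally have "real p * \<bar>real (card ?C) - of_int ?S / real p\<bar> \<le> real p * (M * (1 + ln (real p)))"
    by (simp only: abs_mult abs_of_nat)
  then have "\<bar>real (card ?C) - of_int ?S / real p\<bar> \<le> M * (1 + ln (real p))"
    using p_pos by (simp only: mult_le_cancel_left_pos)
  then show ?thesis by (simp add: J_def M_def)
qed

section \<open>Sizes of the two sets\<close>

text \<open>The two conditions force \<open>p \<le> 3 * x\<close>, so the set is a single strip.
  Scaled by \<open>1 / p\<close>, it is the triangle \<open>1 - x \<le> y \<le> 2 * x\<close>,
  \<open>x \<le> 1 / 2\<close>, of area 1/24.\<close>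

lemma card_B_plus:
  assumes "p > 81"
  shows "\<bar>real (card (B_plus p)) - real p / 24\<bar> \<le> 9 / 2 * real p powr (3/4) * (1 + ln (real p)) + 1"
proof -
  have "odd p" using prime_odd_nat[OF prime_p] assms by simp
  then obtain k' where "p = 2 * k' + 1" by (rule oddE)
  then obtain k where k: "int p = 2 * k + 1" by (intro that[of "int k'"]) simp
  \<comment> \<open>The ceiling of \<open>p / 3\<close>, the least \<open>x\<close> with
    \<open>p - x \<le> 2 * x\<close>. The upper end \<open>(p - 3) / 2\<close> is
    \<open>k - 1\<close>.\<close>
  define X where "X = (int p + 2) div 3"
  have X: "3 * X = int p \<or> 3 * X = int p + 1 \<or> 3 * X = int p + 2"
    unfolding X_def by presburger
  define S where "S = (\<Sum>x\<in>{X..k - 1}. 2 * x + 0 + 1 - (- 1 * x + int p))"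
  have "real_of_int x \<le> (real p - 3) / 2 \<longleftrightarrow> x \<le> k - 1" for x
    using arg_cong[OF k, of real_of_int] by auto
  moreover have "X \<le> x" if "x + y \<ge> int p" "y \<le> 2 * x" for x y
    using X that by linarith
  ultimately have B: "B_plus p = {x \<in> {X..k - 1}. - 1 * x + int p \<le> inv_mod p x \<and> inv_mod p x \<le> 2 * x + 0}"
    using X assms unfolding B_plus_def by auto
  have count: "\<bar>real (card (B_plus p)) - of_int S / real p\<bar> \<le> 9 / 2 * real p powr (3/4) * (1 + ln (real p))"
    unfolding B S_def by (rule count_inverses_in_strip) (use X k assms in auto)
  have "S = (\<Sum>x\<in>{X..k - 1}. 3 * x + (1 - int p))"
    unfolding S_def by (intro sum.cong) auto
  then have "2 * S = (k - 1 + 1 - X) * (3 * (X + (k - 1)) + 2 * (1 - int p))"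
    using X k assms by (simp only:) (intro sum_affine_interval, linarith)
  then have "6 * S = (3 * k - 3 * X) * (3 * X + 3 * k - 4 * k - 3)"
    by (simp add: k algebra_simps)
  \<comment> \<open>Here \<open>t\<close> records the rounding in \<open>X\<close>; it changes only
    lower-order terms, which the slack of \<open>24 * p\<close> covers.\<close>
  then have S: "\<bar>24 * S - int p * int p\<bar> \<le> 24 * int p"
  proof -
    obtain t where t: "3 * X = 2 * k + 1 + t" "t = 0 \<or> t = 1 \<or> t = 2"
      using X k by (intro that[of "3 * X - (2 * k + 1)"]) auto
    have "6 * S = (k - 1 - t) * (k - 2 + t)"
      unfolding \<open>6 * S = _\<close> t(1) by (simp add: algebra_simps)
    moreover have "k \<ge> 41" using k assms by linarith
    ultimately show ?thesis using t(2) unfolding k by (auto simp: algebra_simps)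
  qed
  then have "\<bar>24 * real_of_int S - real p * real p\<bar> \<le> 24 * real p"
    using of_int_le_iff[where ?'a = real, THEN iffD2, OF S] by simp
  then have "\<bar>of_int S / real p - real p / 24\<bar> \<le> 1"
    using p_pos by (simp add: abs_le_iff field_simps)
  with count show ?thesis by linarith
qed

text \<open>
  The slices of \<open>B_minus\<close> at fixed \<open>\<beta>\<close> have an end of slope \<open>-1/2\<close>. Slicing at fixed \<open>y = \<beta>\<^sup>-\<^sup>1\<close>
  makes all slopes integral, with the lower end changing from \<open>p - 1 - 2 * y\<close> to \<open>y + 1\<close> at
  \<open>y = p / 3\<close>.
\<close>

lemma card_B_minus:
  assumes "p > 81"
  shows "\<bar>real (card (B_minus p)) - real p / 48\<bar> \<le> 9 * real p powr (3/4) * (1 + ln (real p)) + 1"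
proof -
  have "odd p" using prime_odd_nat[OF prime_p] assms by simp
  then obtain k' where "p = 2 * k' + 1" by (rule oddE)
  then obtain k where k: "int p = 2 * k + 1" by (intro that[of "int k'"]) simp
  \<comment> \<open>\<open>Y\<close> is the least \<open>y\<close> with
    \<open>2 * k - 2 * y \<le> k\<close>, where the slice ending at \<open>k - 1\<close> has
    nonnegative length. \<open>Z\<close> is the last \<open>y\<close> with
    \<open>y + 1 \<le> 2 * k - 2 * y\<close>; beyond it \<open>y + 1\<close> is the larger lower
    end.\<close>
  define Y where "Y = (k + 1) div 2"
  define Z where "Z = (2 * k - 1) div 3"
  have Y: "2 * Y = k \<or> 2 * Y = k + 1"
    unfolding Y_def by presburger
  have Z: "3 * Z = 2 * k - 1 \<or> 3 * Z = 2 * k - 2 \<or> 3 * Z = 2 * k - 3"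
    unfolding Z_def by presburger
  define S T where "S = (\<Sum>y\<in>{Y..Z}. 0 * y + (k - 1) + 1 - (- 2 * y + 2 * k))"
    and "T = (\<Sum>y\<in>{Z + 1..k - 1}. 0 * y + (k - 1) + 1 - (1 * y + 1))"
  let ?C = "{y \<in> {Y..Z}. - 2 * y + 2 * k \<le> inv_mod p y \<and> inv_mod p y \<le> 0 * y + (k - 1)}"
  let ?D = "{y \<in> {Z + 1..k - 1}. 1 * y + 1 \<le> inv_mod p y \<and> inv_mod p y \<le> 0 * y + (k - 1)}"
  have half: "real_of_int x \<le> (real p - 3) / 2 \<longleftrightarrow> x \<le> k - 1" for x
    using arg_cong[OF k, of real_of_int] by auto
  have mem: "\<beta> \<in> B_minus p \<longleftrightarrow> \<beta> \<in> {1..<int p} \<and> inv_mod p \<beta> \<in> ?C \<union> ?D" for \<beta>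
  proof (cases "\<beta> \<in> {1..<int p}")
    case True
    define i where "i = inv_mod p \<beta>"
    have "\<beta> \<le> k - 1 \<and> 2 * k \<le> \<beta> + 2 * i \<and> i < \<beta> \<longleftrightarrow>
        Y \<le> i \<and> i \<le> Z \<and> 2 * k - 2 * i \<le> \<beta> \<and> \<beta> \<le> k - 1 \<or>
        Z + 1 \<le> i \<and> i \<le> k - 1 \<and> i + 1 \<le> \<beta> \<and> \<beta> \<le> k - 1"
      using Y Z by linarith
    then show ?thesis
      using True inv_mod_inv_mod[OF True] unfolding B_minus_def mem_Collect_eq half
      by (simp add: k flip: i_def)
  next
    case False
    then show ?thesis
      unfolding B_minus_def mem_Collect_eq half atLeastLessThan_iff k by linarith
  qed
  have range: "?C \<union> ?D \<subseteq> {1..<int p}" using Y Z k assms by auto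
  \<comment> \<open>Inversion is an involution on nonzero residues, so it exchanges the two ways of
    slicing.\<close>
  have "bij_betw (inv_mod p) (B_minus p) (?C \<union> ?D)"
  proof (rule bij_betwI[of _ _ _ "inv_mod p"])
    show "inv_mod p \<in> B_minus p \<rightarrow> ?C \<union> ?D" using mem by blast
    show "inv_mod p \<in> ?C \<union> ?D \<rightarrow> B_minus p"
    proof (rule Pi_I)
      fix y assume y: "y \<in> ?C \<union> ?D"
      with range have U: "y \<in> {1..<int p}" by (rule subsetD)
      show "inv_mod p y \<in> B_minus p"
        unfolding mem inv_mod_inv_mod[OF U] using inv_mod_range[OF U] y by (rule conjI)
    qed
    show "inv_mod p (inv_mod p x) = x" if "x \<in> B_minus p" for x
      using that unfolding mem by (blast intro: inv_mod_inv_mod)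
    show "inv_mod p (inv_mod p y) = y" if "y \<in> ?C \<union> ?D" for y
      by (rule inv_mod_inv_mod) (rule subsetD[OF range that])
  qed
  then have "card (B_minus p) = card (?C \<union> ?D)" by (rule bij_betw_same_card)
  also have "\<dots> = card ?C + card ?D"
  proof (rule card_Un_disjoint)
    show "finite ?C" "finite ?D" by (rule finite_Collect_conjI; simp)+
    show "?C \<inter> ?D = {}" by auto
  qed
  finally have card: "card (B_minus p) = card ?C + card ?D" .
  have count: "\<bar>real (card ?C) - of_int S / real p\<bar> \<le> 9 / 2 * real p powr (3/4) * (1 + ln (real p))"
    "\<bar>real (card ?D) - of_int T / real p\<bar> \<le> 9 / 2 * real p powr (3/4) * (1 + ln (real p))"
    unfolding S_def T_def by (rule count_inverses_in_strip; use Y Z k assms in force)+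
  have "S = (\<Sum>y\<in>{Y..Z}. 2 * y + (- k))" "T = (\<Sum>y\<in>{Z + 1..k - 1}. - 1 * y + (k - 1))"
    unfolding S_def T_def by (intro sum.cong; simp)+
  then have "2 * S = (Z + 1 - Y) * (2 * (Y + Z) + 2 * (- k))"
    "2 * T = (k - 1 + 1 - (Z + 1)) * (- 1 * (Z + 1 + (k - 1)) + 2 * (k - 1))"
    by (simp only:, intro sum_affine_interval, use Y Z k assms in linarith)+
  then have "36 * S = (2 * (3 * Z) + 6 - 3 * (2 * Y)) * (3 * (2 * Y) + 2 * (3 * Z) - 6 * k)"
    "18 * T = (3 * k - 3 * Z - 3) * (3 * k - 3 * Z - 6)"
    by (simp_all add: algebra_simps)
  \<comment> \<open>The scaled pieces have areas 1/144 and 1/72, with sum 1/48; \<open>t\<close> and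
    \<open>u\<close> record the rounding in \<open>Y\<close> and \<open>Z\<close>.\<close>
  then have S: "\<bar>48 * (S + T) - int p * int p\<bar> \<le> 48 * int p"
  proof -
    obtain t where t: "2 * Y = k + t" "t = 0 \<or> t = 1"
      using Y by (intro that[of "2 * Y - k"]) auto
    obtain u where u: "3 * Z = 2 * k - 1 - u" "u = 0 \<or> u = 1 \<or> u = 2"
      using Z by (intro that[of "2 * k - 1 - 3 * Z"]) auto
    have "36 * S = (k + 4 - 2 * u - 3 * t) * (k - 2 - 2 * u + 3 * t)"
      unfolding \<open>36 * S = _\<close> t(1) u(1) by (simp add: algebra_simps)
    moreover have "18 * T = (k - 2 + u) * (k - 5 + u)"
      unfolding \<open>18 * T = _\<close> u(1) by (simp add: algebra_simps)
    moreover have "k \<ge> 41" using k assms by linarith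
    ultimately show ?thesis using t(2) u(2) unfolding k by (auto simp: algebra_simps)
  qed
  then have "\<bar>48 * (real_of_int S + real_of_int T) - real p * real p\<bar> \<le> 48 * real p"
    using of_int_le_iff[where ?'a = real, THEN iffD2, OF S] by simp
  then have "\<bar>of_int S / real p + of_int T / real p - real p / 48\<bar> \<le> 1"
    using p_pos by (simp add: abs_le_iff field_simps)
  with count show ?thesis unfolding card of_nat_add by linarith
qed

section \<open>Final constants and small primes\<close>

text \<open>Since \<open>exp 4 \<le> 3 ^ 4 = 81 < p\<close>, the logarithm is at least 4, and
  \<open>3 * ln p\<close> absorbs the remaining 9 and 1.\<close>

lemma error_term_le:
  assumes "p > 81"
  shows "9 * real p powr (3/4) * (1 + ln (real p)) + 1 \<le> 12 * real p powr (3/4) * ln (real p)"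
proof -
  let ?P = "real p powr (3/4)" and ?L = "ln (real p)"
  have "?P \<ge> 1" using p_gt_1 by (intro ge_one_powr_ge_zero) auto
  have "exp 4 = (exp 1 ^ 4 :: real)" by (simp flip: exp_of_nat_mult)
  also have "\<dots> \<le> (3 ^ 4 :: real)" by (intro power_mono exp_le) auto
  also have "\<dots> \<le> real p" using assms by simp
  finally have "?L \<ge> 4" using p_pos by (simp add: ln_ge_iff)
  then have "?P * 4 \<le> ?P * ?L" using \<open>?P \<ge> 1\<close> by (intro mult_left_mono) auto
  then show ?thesis using \<open>?P \<ge> 1\<close> by (simp add: algebra_simps)
qed

text \<open>The deviation is trivially at most \<open>p\<close>, and
  \<open>p powr (1/4) \<le> 3 \<le> 12 * ln 2\<close> for these \<open>p\<close>.\<close>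

lemma card_deviation_small_p:
  assumes "p \<le> 81" "B \<subseteq> {1..int p}" "0 \<le> c" "c \<le> real p"
  shows "\<bar>real (card B) - c\<bar> \<le> 12 * real p powr (3/4) * ln (real p)"
proof -
  let ?P = "real p powr (3/4)"
  have "card B \<le> card {1..int p}" using assms by (intro card_mono) auto
  then have "\<bar>real (card B) - c\<bar> \<le> real p" using assms by auto
  also have "real p = ?P * real p powr (1/4)" using p_pos by (simp flip: powr_add)
  also have "\<dots> \<le> ?P * (12 * ln (real p))"
  proof (intro mult_left_mono)
    have "real p powr (1/4) \<le> 81 powr (1/4)" using assms by (intro powr_mono2) auto
    also have "(81 :: real) powr (1/4) = (3 powr 4) powr (1/4)" by simp
    also have "\<dots> = 3" by (simp only: powr_powr) simp
    also have "3 \<le> 12 * ln (2 :: real)" using ln2_ge_two_thirds by simp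
    also have "\<dots> \<le> 12 * ln (real p)" using p_gt_1 by simp
    finally show "real p powr (1/4) \<le> 12 * ln (real p)" .
  qed simp
  finally show ?thesis by (simp add: mult_ac)
qed

lemma B_subset: "B_minus p \<subseteq> {1..int p}" "B_plus p \<subseteq> {1..int p}"
  unfolding B_minus_def B_plus_def by auto

lemma B_minus_bound: "\<bar>real (card (B_minus p)) - real p / 48\<bar> \<le> 12 * real p powr (3/4) * ln (real p)"
proof (cases "p > 81")
  case True
  from card_B_minus[OF this] error_term_le[OF this] show ?thesis by linarith
qed (use B_subset in \<open>auto intro!: card_deviation_small_p\<close>)

lemma B_plus_bound: "\<bar>real (card (B_plus p)) - real p / 24\<bar> \<le> 12 * real p powr (3/4) * ln (real p)"
proof (cases "p > 81")
  case True
  have "0 \<le> 9 / 2 * real p powr (3/4) * (1 + ln (real p))" using p_gt_1 by simp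
  with card_B_plus[OF True] error_term_le[OF True] show ?thesis by linarith
qed (use B_subset in \<open>auto intro!: card_deviation_small_p\<close>)

text \<open>In \<open>B_minus\<close> the inverse is smaller than \<open>\<beta>\<close>, which is
  below \<open>p / 2\<close>, so their sum stays below \<open>p\<close>, against the condition in
  \<open>B_plus\<close>.\<close>

lemma card_B_set: "card (B_set p) = card (B_minus p) + card (B_plus p)"
  unfolding B_set_def
proof (rule card_Un_disjoint)
  show "finite (B_minus p)" "finite (B_plus p)"
    using B_subset by (auto intro: finite_subset)
  show "B_minus p \<inter> B_plus p = {}"
    unfolding B_minus_def B_plus_def by auto
qed

end

theorem theorem2:
  fixes p :: nat
  assumes "prime p"
  shows "\<bar>real (card (B_minus p)) - real p / 48\<bar> \<le> 12 * real p powr (3/4) * ln (real p)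
    \<and> \<bar>real (card (B_plus p)) - real p / 24\<bar> \<le> 12 * real p powr (3/4) * ln (real p)
    \<and> \<bar>real (card (B_set p)) - real p / 16\<bar> \<le> 24 * real p powr (3/4) * ln (real p)"
proof -
  interpret prime_modulus p by (standard, fact)
  show ?thesis
    using B_minus_bound B_plus_bound by (simp add: card_B_set)
qed

end
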